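(* For $n\geq 2$, there is no $\Delta^0_n$-complete equivalence relation. That is, for every $n\ge 2$ and every $\Delta^0_n$ equivalence relation $E$ on $\mathbb{N}$ there is a $\Delta^0_n$ equivalence relation $F$ on $\mathbb{N}$ with $F\nleq E$.
   Context: For binary relations $A,B$ on $\mathbb{N}$, $A\le B$ (computable component-wise reducibility) means there is a computable function $f:\mathbb{N}\to\mathbb{N}$ with $(x,y)\in A\iff (f(x),f(y))\in B$ for all $x,y\in\mathbb{N}$. $\Delta^0_n=\Sigma^0_n\cap\Pi^0_n$ in the arithmetical hierarchy; a $\Delta^0_n$ equivalence relation is an equivalence relation on $\mathbb{N}$ that is $\Delta^0_n$ as a set of pairs. An equivalence relation $E$ is $\Delta^0_n$-complete if it is $\Delta^0_n$ and $F\le E$ for every $\Delta^0_n$ equivalence relation $F$. *)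

theory Defs
  imports Main
begin

text \<open>
  Programs for Kleene's \<open>\<mu>\<close>-recursive partial functions.  They carry no arity: a program is run
  on an argument list, and for every \<open>k\<close> it computes a partial function on the lists of length
  \<open>k\<close>.  Where \<open>Succ\<close>, \<open>Proj\<close> or \<open>PrimRec\<close> get a list of an unsuitable length, there is no value.
\<close>

datatype recf =
    Zero
  | Succ
  | Proj nat
  | Comp recf "recf list"
  | PrimRec recf recf
  | Mu recf

text \<open>
  \<open>evaluates p xs y\<close>: on input \<open>xs\<close> the program \<open>p\<close> halts with output \<open>y\<close>.  Unbounded search is
  partial: the program searched over has to halt on all candidates below the first zero.
\<close>

inductive evaluates :: "recf \<Rightarrow> nat list \<Rightarrow> nat \<Rightarrow> bool" where
  Zero: "evaluates Zero xs 0"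
| Succ: "evaluates Succ [x] (Suc x)"
| Proj: "i < length xs \<Longrightarrow> evaluates (Proj i) xs (xs ! i)"
| Comp: "list_all2 (\<lambda>g y. evaluates g xs y) gs ys \<Longrightarrow> evaluates f ys z
    \<Longrightarrow> evaluates (Comp f gs) xs z"
| PrimRec_0: "evaluates f xs y \<Longrightarrow> evaluates (PrimRec f g) (0 # xs) y"
| PrimRec_Suc: "evaluates (PrimRec f g) (m # xs) y \<Longrightarrow> evaluates g (m # y # xs) z
    \<Longrightarrow> evaluates (PrimRec f g) (Suc m # xs) z"
| Mu: "evaluates f (z # xs) 0 \<Longrightarrow> \<forall>i<z. \<exists>v>0. evaluates f (i # xs) v
    \<Longrightarrow> evaluates (Mu f) xs z"

inductive_cases evaluates_ZeroE: "evaluates Zero xs y"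
inductive_cases evaluates_SuccE: "evaluates Succ xs y"
inductive_cases evaluates_ProjE: "evaluates (Proj i) xs y"
inductive_cases evaluates_CompE: "evaluates (Comp f gs) xs y"
inductive_cases evaluates_PrimRec_0E: "evaluates (PrimRec f g) (0 # xs) y"
inductive_cases evaluates_PrimRec_SucE: "evaluates (PrimRec f g) (Suc m # xs) y"
inductive_cases evaluates_MuE: "evaluates (Mu f) xs y"

lemma evaluates_deterministic:
  "evaluates p xs y \<Longrightarrow> evaluates p xs y' \<Longrightarrow> y = y'"
proof (induction arbitrary: y' rule: evaluates.induct)
  case (Zero xs)
  then show ?case by (rule evaluates_ZeroE) simp
next
  case (Succ x)
  then show ?case by (rule evaluates_SuccE) simp
next
  case (Proj i xs)
  from Proj.prems show ?case by (rule evaluates_ProjE) simp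
next
  case (Comp xs gs ys f z)
  from Comp.prems obtain ys' where ys': "list_all2 (\<lambda>g y. evaluates g xs y) gs ys'"
    and f: "evaluates f ys' y'"
    by (rule evaluates_CompE)
  have "ys = ys'"
    using Comp.IH(1) ys' by (auto simp: list_all2_conv_all_nth intro!: nth_equalityI)
  with f have "evaluates f ys y'" by simp
  then show ?case by (rule Comp.IH(2))
next
  case (PrimRec_0 f xs y g)
  from PrimRec_0.prems have "evaluates f xs y'" by (rule evaluates_PrimRec_0E)
  then show ?case by (rule PrimRec_0.IH)
next
  case (PrimRec_Suc f g m xs y z)
  from PrimRec_Suc.prems obtain w where w: "evaluates (PrimRec f g) (m # xs) w"
    and g: "evaluates g (m # w # xs) y'"
    by (rule evaluates_PrimRec_SucE)
  from w have "y = w" by (rule PrimRec_Suc.IH(1))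
  with g have "evaluates g (m # y # xs) y'" by simp
  then show ?case by (rule PrimRec_Suc.IH(2))
next
  case (Mu f z xs)
  from Mu.prems have 0: "evaluates f (y' # xs) 0"
    and pos: "\<forall>i<y'. \<exists>v>0. evaluates f (i # xs) v"
    by (auto elim!: evaluates_MuE)
  consider "z < y'" | "z = y'" | "y' < z" by linarith
  then show ?case
  proof cases
    case 1
    with pos obtain v where "v > 0" "evaluates f (z # xs) v" by blast
    with Mu.IH(1)[of v] show ?thesis by simp
  next
    case 3
    with Mu.IH(2) obtain v where "v > 0" "\<And>u. evaluates f (y' # xs) u \<Longrightarrow> v = u" by blast
    with 0 show ?thesis by fastforce
  qed
qed

definition computable :: "nat \<Rightarrow> (nat list \<Rightarrow> nat) \<Rightarrow> bool" where
  "computable k f \<longleftrightarrow> (\<exists>p. \<forall>xs. length xs = k \<longrightarrow> evaluates p xs (f xs))"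

definition computable1 :: "(nat \<Rightarrow> nat) \<Rightarrow> bool" where
  "computable1 f \<longleftrightarrow> computable 1 (\<lambda>xs. f (hd xs))"

text \<open>
  A \<open>k\<close>-ary relation on the natural numbers is a set of lists of which only the members of length
  \<open>k\<close> matter.  Level 0 of the hierarchy consists of the computable relations.
\<close>

definition decidable :: "nat \<Rightarrow> nat list set \<Rightarrow> bool" where
  "decidable k A \<longleftrightarrow> computable k (\<lambda>xs. if xs \<in> A then 1 else 0)"

fun Sigma0 :: "nat \<Rightarrow> nat \<Rightarrow> nat list set \<Rightarrow> bool"
  and Pi0 :: "nat \<Rightarrow> nat \<Rightarrow> nat list set \<Rightarrow> bool" where
  "Sigma0 0 k A \<longleftrightarrow> decidable k A"
| "Sigma0 (Suc n) k A \<longleftrightarrow>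
    (\<exists>R. Pi0 n (Suc k) R \<and> (\<forall>xs. length xs = k \<longrightarrow> (xs \<in> A \<longleftrightarrow> (\<exists>y. y # xs \<in> R))))"
| "Pi0 0 k A \<longleftrightarrow> decidable k A"
| "Pi0 (Suc n) k A \<longleftrightarrow>
    (\<exists>R. Sigma0 n (Suc k) R \<and> (\<forall>xs. length xs = k \<longrightarrow> (xs \<in> A \<longleftrightarrow> (\<forall>y. y # xs \<in> R))))"

definition Delta0 :: "nat \<Rightarrow> nat \<Rightarrow> nat list set \<Rightarrow> bool" where
  "Delta0 n k A \<longleftrightarrow> Sigma0 n k A \<and> Pi0 n k A"

definition Delta0_equiv :: "nat \<Rightarrow> (nat \<times> nat) set \<Rightarrow> bool" where
  "Delta0_equiv n E \<longleftrightarrow> equiv UNIV E \<and> Delta0 n 2 {[x, y] | x y. (x, y) \<in> E}"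

definition computably_reducible :: "(nat \<times> nat) set \<Rightarrow> (nat \<times> nat) set \<Rightarrow> bool" where
  "computably_reducible A B \<longleftrightarrow>
    (\<exists>f. computable1 f \<and> (\<forall>x y. (x, y) \<in> A \<longleftrightarrow> (f x, f y) \<in> B))"

definition Delta0_complete_equiv :: "nat \<Rightarrow> (nat \<times> nat) set \<Rightarrow> bool" where
  "Delta0_complete_equiv n E \<longleftrightarrow>
    Delta0_equiv n E \<and> (\<forall>F. Delta0_equiv n F \<longrightarrow> computably_reducible F E)"

end

theory Submission
  imports Defs "HOL-Library.Nat_Bijection"
begin

text \<open>
  Diagonalise on disjoint pairs: let \<open>2e\<close> and \<open>2e + 1\<close> be equivalent under \<open>F\<close> iff the \<open>e\<close>-th partial
  computable function converges on both of them and its two values are inequivalent under \<open>E\<close>;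
  apart from this all classes are singletons.  This is an equivalence relation whatever \<open>E\<close> is,
  and the \<open>e\<close>-th function, if total, is not a reduction to \<open>E\<close> because of the \<open>e\<close>-th pair.
  Totality never has to be decided, only convergence at two arguments, which is a \<open>\<Sigma>\<^sub>1\<close>
  question and hence \<open>\<Delta>\<^sub>n\<close> for \<open>n \<ge> 2\<close>.

  Convergence is \<open>\<Sigma>\<^sub>1\<close> because a computation is witnessed by a finite set of codes of judgements,
  each of which follows from members of the set by one rule; finite sets are coded by binary
  expansions.  No well-foundedness of the set is required: soundness is by induction on the
  program and, for primitive recursion, on the recursion argument.
\<close>

section \<open>Computable functions\<close>

text \<open>Unlike \<open>xs ! i\<close>, this commutes with \<open>tl\<close> and is computable unconditionally.\<close>

definition arg :: "nat \<Rightarrow> nat list \<Rightarrow> nat" where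
  "arg i xs = (if i < length xs then xs ! i else 0)"

lemma arg_tl: "arg i (tl xs) = arg (Suc i) xs"
  by (auto simp: arg_def nth_tl)

lemma arg_Cons [simp]: "arg 0 (x # xs) = x" "arg (Suc i) (x # xs) = arg i xs"
  by (auto simp: arg_def)

lemma arg_numeral_Cons [simp]: "arg (numeral v) (x # xs) = arg (pred_numeral v) xs"
  by (simp add: numeral_eq_Suc)

lemma map_arg: "length xs = k \<Longrightarrow> map (\<lambda>i. arg i xs) [0..<k] = xs"
  by (auto simp: arg_def intro: nth_equalityI)

lemma map_arg_Suc: "length xs = Suc k \<Longrightarrow> map (\<lambda>i. arg (Suc i) xs) [0..<k] = tl xs"
  by (auto simp: arg_def nth_tl intro: nth_equalityI)

lemma computable_cong:
  "(\<And>xs. length xs = k \<Longrightarrow> f xs = g xs) \<Longrightarrow> computable k f \<longleftrightarrow> computable k g"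
  unfolding computable_def by metis

text \<open>\<open>Comp\<close> realises the substitution; induction on \<open>gs\<close> collects
  one program for each member.\<close>

lemma computable_compose:
  assumes h: "computable (length gs) h" and gs: "\<And>g. g \<in> set gs \<Longrightarrow> computable k g"
  shows "computable k (\<lambda>xs. h (map (\<lambda>g. g xs) gs))"
proof -
  from h obtain p where p: "\<And>ys. length ys = length gs \<Longrightarrow> evaluates p ys (h ys)"
    unfolding computable_def by auto
  have "\<exists>qs. \<forall>xs. length xs = k \<longrightarrow> list_all2 (\<lambda>q y. evaluates q xs y) qs (map (\<lambda>g. g xs) gs)"
    using gs
  proof (induction gs)
    case Nil
    then show ?case by (auto intro: exI[of _ "[]"])
  next
    case (Cons g gs)
    then obtain qs where
      "\<forall>xs. length xs = k \<longrightarrow> list_all2 (\<lambda>q y. evaluates q xs y) qs (map (\<lambda>g. g xs) gs)"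
      by auto
    moreover from Cons.prems obtain q where "\<forall>xs. length xs = k \<longrightarrow> evaluates q xs (g xs)"
      unfolding computable_def by (meson list.set_intros(1))
    ultimately show ?case
      by (intro exI[of _ "q # qs"]) simp
  qed
  then obtain qs where
    "\<forall>xs. length xs = k \<longrightarrow> list_all2 (\<lambda>q y. evaluates q xs y) qs (map (\<lambda>g. g xs) gs)"
    by auto
  then have "\<forall>xs. length xs = k \<longrightarrow> evaluates (Comp p qs) xs (h (map (\<lambda>g. g xs) gs))"
    using p by (auto intro!: evaluates.Comp)
  then show ?thesis unfolding computable_def by blast
qed

lemma computable_compose1:
  assumes "computable 1 (\<lambda>ys. h (arg 0 ys))" "computable k f"
  shows "computable k (\<lambda>xs. h (f xs))"
  using computable_compose[of "[f]" "\<lambda>ys. h (arg 0 ys)" k] assms by simp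

lemma computable_compose2:
  assumes "computable 2 (\<lambda>ys. h (arg 0 ys) (arg 1 ys))" "computable k f" "computable k g"
  shows "computable k (\<lambda>xs. h (f xs) (g xs))"
  using computable_compose[of "[f, g]" "\<lambda>ys. h (arg 0 ys) (arg 1 ys)" k] assms
  by (auto simp: numeral_2_eq_2)

lemma computable_zero: "computable k (\<lambda>xs. 0)"
  unfolding computable_def by (blast intro: evaluates.Zero)

lemma computable_arg: "computable k (\<lambda>xs. arg i xs)"
proof (cases "i < k")
  case True
  then show ?thesis
    unfolding computable_def by (auto intro!: exI[of _ "Proj i"] evaluates.Proj simp: arg_def)
next
  case False
  then have "computable k (\<lambda>xs. arg i xs) \<longleftrightarrow> computable k (\<lambda>xs. 0)"
    by (intro computable_cong) (simp add: arg_def)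
  then show ?thesis by (simp add: computable_zero)
qed

lemma computable_Suc:
  assumes "computable k f"
  shows "computable k (\<lambda>xs. Suc (f xs))"
proof (rule computable_compose1[OF _ assms])
  show "computable 1 (\<lambda>ys. Suc (arg 0 ys))"
    unfolding computable_def
    by (rule exI[of _ Succ]) (auto simp: length_Suc_conv intro: evaluates.Succ)
qed

lemma computable_const: "computable k (\<lambda>xs. c)"
  by (induction c) (auto intro: computable_zero computable_Suc)

text \<open>On lists of length \<open>k\<close> the tuple of all projections is the identity, so
  this is an instance of substitution.\<close>

lemma computable_subst_hd:
  assumes "computable (Suc k) h" "computable k b"
  shows "computable k (\<lambda>xs. h (b xs # xs))"
proof -
  have "computable k (\<lambda>xs. h (map (\<lambda>g. g xs) (b # map arg [0..<k])))"
    using assms computable_arg by (intro computable_compose) auto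
  then show ?thesis
    by (rule computable_cong[THEN iffD1, rotated]) (simp add: map_arg comp_def)
qed

text \<open>\<open>PrimRec\<close> computes \<open>rec_nat\<close> with the recursion argument at
  the head of the list; \<open>b\<close> is substituted for the head afterwards. The step
  \<open>g\<close> takes counter, previous value and parameters separately.\<close>

lemma computable_rec_nat:
  assumes f: "computable k f"
    and g: "computable (Suc (Suc k)) (\<lambda>ys. g (arg 0 ys) (arg 1 ys) (tl (tl ys)))"
    and b: "computable k b"
  shows "computable k (\<lambda>xs. rec_nat (f xs) (\<lambda>m y. g m y xs) (b xs))"
proof -
  from f obtain p where p: "\<And>xs. length xs = k \<Longrightarrow> evaluates p xs (f xs)"
    unfolding computable_def by auto
  from g obtain q where
    q: "\<And>ys. length ys = Suc (Suc k) \<Longrightarrow> evaluates q ys (g (arg 0 ys) (arg 1 ys) (tl (tl ys)))"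
    unfolding computable_def by auto
  have rec: "evaluates (PrimRec p q) (m # xs) (rec_nat (f xs) (\<lambda>m y. g m y xs) m)"
    if "length xs = k" for m xs
  proof (induction m)
    case 0
    with that p show ?case by (auto intro: evaluates.PrimRec_0)
  next
    case (Suc m)
    let ?y = "rec_nat (f xs) (\<lambda>m y. g m y xs) m"
    have "evaluates q (m # ?y # xs) (g m ?y xs)"
      using q[of "m # ?y # xs"] that by simp
    with Suc show ?case by (auto intro: evaluates.PrimRec_Suc)
  qed
  have "computable (Suc k) (\<lambda>ys. rec_nat (f (tl ys)) (\<lambda>m y. g m y (tl ys)) (arg 0 ys))"
    unfolding computable_def
    by (rule exI[of _ "PrimRec p q"]) (auto simp: length_Suc_conv intro: rec)
  from computable_subst_hd[OF this b] show ?thesis by simp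
qed

section \<open>Arithmetical functions as primitive recursions\<close>

lemma computable_add:
  assumes "computable k f" "computable k g"
  shows "computable k (\<lambda>xs. f xs + g xs)"
proof -
  have "rec_nat a (\<lambda>m y. Suc y) b = a + b" for a b :: nat
    by (induction b) auto
  with computable_rec_nat[of k f "\<lambda>m y xs. Suc y" g] assms show ?thesis
    by (simp add: computable_Suc computable_arg)
qed

lemma computable_mult:
  assumes "computable k f" "computable k g"
  shows "computable k (\<lambda>xs. f xs * g xs)"
proof (rule computable_compose2[OF _ assms])
  have "rec_nat 0 (\<lambda>m y. y + a) b = a * b" for a b :: nat
    by (induction b) auto
  with computable_rec_nat[of 2 "\<lambda>xs. 0" "\<lambda>m y xs. y + arg 0 xs" "arg 1"]
  show "computable 2 (\<lambda>ys. arg 0 ys * arg 1 ys)"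
    by (simp add: computable_add computable_arg computable_zero arg_tl)
qed

lemma computable_diff:
  assumes "computable k f" "computable k g"
  shows "computable k (\<lambda>xs. f xs - g xs)"
proof -
  have "rec_nat 0 (\<lambda>m y. m) a = a - Suc 0" for a :: nat
    by (cases a) auto
  with computable_rec_nat[of 1 "\<lambda>xs. 0" "\<lambda>m y xs. m" "arg 0"]
  have "computable 1 (\<lambda>ys. arg 0 ys - Suc 0)"
    by (simp add: computable_zero computable_arg)
  then have pred: "computable j (\<lambda>xs. h xs - Suc 0)" if "computable j h" for j h
    using that by (rule computable_compose1)
  have "rec_nat a (\<lambda>m y. y - Suc 0) b = a - b" for a b :: nat
    by (induction b) auto
  with computable_rec_nat[of k f "\<lambda>m y xs. y - Suc 0" g] assms show ?thesis
    by (simp add: pred computable_arg)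
qed

lemma computable_mod2:
  assumes "computable k f"
  shows "computable k (\<lambda>xs. f xs mod 2)"
proof -
  have "rec_nat 0 (\<lambda>m y. 1 - y) a = a mod 2" for a :: nat
    by (induction a) (auto simp: mod_Suc)
  with computable_rec_nat[of k "\<lambda>xs. 0" "\<lambda>m y xs. 1 - y" f] assms show ?thesis
    by (simp add: computable_zero computable_arg computable_diff computable_const)
qed

lemma computable_div2:
  assumes "computable k f"
  shows "computable k (\<lambda>xs. f xs div 2)"
proof -
  \<comment> \<open>The half goes up exactly in passing from an odd \<open>m\<close> to
    \<open>Suc m\<close>.\<close>
  have "rec_nat 0 (\<lambda>m y. y + m mod 2) a = a div 2" for a :: nat
    by (induction a) (simp_all, presburger)
  with computable_rec_nat[of k "\<lambda>xs. 0" "\<lambda>m y xs. y + m mod 2" f] assms show ?thesis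
    by (simp add: computable_zero computable_arg computable_add computable_mod2)
qed

lemma computable_prod_encode:
  assumes "computable k f" "computable k g"
  shows "computable k (\<lambda>xs. prod_encode (f xs, g xs))"
proof -
  have "rec_nat 0 (\<lambda>m y. y + Suc m) a = triangle a" for a :: nat
    by (induction a) auto
  with computable_rec_nat[of 1 "\<lambda>xs. 0" "\<lambda>m y xs. y + Suc m" "arg 0"]
  have "computable 1 (\<lambda>ys. triangle (arg 0 ys))"
    by (simp add: computable_zero computable_arg computable_add computable_Suc)
  then have "computable k (\<lambda>xs. triangle (f xs + g xs))"
    by (rule computable_compose1) (intro computable_add assms)
  with assms show ?thesis
    by (simp add: prod_encode_def computable_add)
qed

section \<open>Decidable relations\<close>

lemma decidable_cong:
  assumes "\<And>xs. length xs = k \<Longrightarrow> xs \<in> A \<longleftrightarrow> xs \<in> B"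
  shows "decidable k A \<longleftrightarrow> decidable k B"
  unfolding decidable_def using assms by (intro computable_cong) simp

lemma decidable_compose:
  assumes "decidable (length gs) A" "\<And>g. g \<in> set gs \<Longrightarrow> computable k g"
  shows "decidable k {xs. map (\<lambda>g. g xs) gs \<in> A}"
  using computable_compose[OF assms[unfolded decidable_def]] by (simp add: decidable_def)

lemma decidable_not:
  assumes "decidable k {xs. P xs}"
  shows "decidable k {xs. \<not> P xs}"
proof -
  have "(if \<not> P xs then 1 else 0) = (1::nat) - (if P xs then 1 else 0)" for xs by simp
  then show ?thesis
    using computable_diff[OF computable_const[of k 1] assms[unfolded decidable_def]]
    by (simp only: decidable_def mem_Collect_eq)
qed

lemma decidable_conj:
  assumes "decidable k {xs. P xs}" "decidable k {xs. Q xs}"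
  shows "decidable k {xs. P xs \<and> Q xs}"
proof -
  have "(if P xs \<and> Q xs then 1 else 0) =
      (if P xs then 1 else 0) * (if Q xs then 1 else (0::nat))" for xs by simp
  then show ?thesis
    using computable_mult[OF assms[unfolded decidable_def]]
    by (simp only: decidable_def mem_Collect_eq)
qed

lemma decidable_disj:
  assumes "decidable k {xs. P xs}" "decidable k {xs. Q xs}"
  shows "decidable k {xs. P xs \<or> Q xs}"
  using decidable_not[OF decidable_conj[OF assms[THEN decidable_not]]] by simp

lemma decidable_imp:
  assumes "decidable k {xs. P xs}" "decidable k {xs. Q xs}"
  shows "decidable k {xs. P xs \<longrightarrow> Q xs}"
  unfolding imp_conv_disj by (intro decidable_disj decidable_not assms)

lemma decidable_less:
  assumes "computable k f" "computable k g"
  shows "decidable k {xs. f xs < g xs}"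
proof -
  have "(if f xs < g xs then 1 else 0) = 1 - (1 - (g xs - f xs))" for xs by simp
  with assms show ?thesis
    by (simp add: decidable_def computable_diff computable_const)
qed

lemma decidable_eq:
  assumes "computable k f" "computable k g"
  shows "decidable k {xs. f xs = g xs}"
proof -
  have "f xs = g xs \<longleftrightarrow> \<not> f xs < g xs \<and> \<not> g xs < f xs" for xs by auto
  with assms show ?thesis
    by (simp only: decidable_conj decidable_not decidable_less)
qed

lemma computable_if:
  assumes "decidable k {xs. P xs}" "computable k f" "computable k g"
  shows "computable k (\<lambda>xs. if P xs then f xs else g xs)"
proof -
  have "(if P xs then f xs else g xs) = (if P xs then 1 else 0) * f xs
      + (1 - (if P xs then 1 else 0)) * g xs" for xs by simp
  then show ?thesis
    using computable_add[OF computable_mult computable_mult[OF computable_diff]] assms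
    by (simp only: decidable_def mem_Collect_eq computable_const)
qed

text \<open>Inserts a second entry that the predicate ignores, such as the previous value in the
  step function of a recursion.\<close>

lemma decidable_tl_tl:
  assumes "decidable (Suc k) {ys. P (arg 0 ys) (tl ys)}"
  shows "decidable (Suc (Suc k)) {ys. P (arg 0 ys) (tl (tl ys))}"
proof -
  let ?gs = "arg 0 # map (\<lambda>i. arg (Suc (Suc i))) [0..<k]"
  have "decidable (Suc (Suc k)) {ys. map (\<lambda>g. g ys) ?gs \<in> {ys. P (arg 0 ys) (tl ys)}}"
    using assms computable_arg by (intro decidable_compose) auto
  moreover have "map (\<lambda>i. arg (Suc (Suc i)) ys) [0..<k] = tl (tl ys)"
    if "length ys = Suc (Suc k)" for ys
    using map_arg_Suc[of "tl ys" k] that by (simp add: arg_tl)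
  ultimately show ?thesis
    by (subst decidable_cong) (auto simp: comp_def)
qed

lemma decidable_bex:
  assumes P: "decidable (Suc k) {ys. P (arg 0 ys) (tl ys)}" and b: "computable k b"
  shows "decidable k {xs. \<exists>i<b xs. P i xs}"
proof -
  \<comment> \<open>Bounded search: the recursion carries a flag that is set once a candidate has
    succeeded.\<close>
  have "rec_nat 0 (\<lambda>m y. if P m xs then 1 else y) n = (if \<exists>i<n. P i xs then 1 else (0::nat))"
    for xs n
    by (induction n) (auto simp: less_Suc_eq)
  moreover have "computable k (\<lambda>xs. rec_nat 0 (\<lambda>m y. if P m xs then 1 else y) (b xs))"
    by (intro computable_rec_nat computable_zero computable_if decidable_tl_tl P computable_const
        computable_arg b)
  ultimately show ?thesis
    by (simp add: decidable_def)
qed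

lemma decidable_ball:
  assumes "decidable (Suc k) {ys. P (arg 0 ys) (tl ys)}" "computable k b"
  shows "decidable k {xs. \<forall>i<b xs. P i xs}"
  using decidable_not[OF decidable_bex[OF decidable_not[OF assms(1)] assms(2)]] by simp

text \<open>Membership of \<open>c\<close> in \<open>set_decode D\<close> is the binary digit of
  \<open>D\<close> at position \<open>c\<close>; halving \<open>c\<close> times moves it to the last
  place.\<close>

lemma decidable_set_decode:
  assumes "computable k f" "computable k g"
  shows "decidable k {xs. f xs \<in> set_decode (g xs)}"
proof -
  have "rec_nat D (\<lambda>m y. y div 2) c = D div 2 ^ c" for D c :: nat
    by (induction c) (auto simp: div_mult2_eq[symmetric] mult.commute)
  with computable_rec_nat[of k g "\<lambda>m y xs. y div 2" f] assms
  have "computable k (\<lambda>xs. g xs div 2 ^ f xs)"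
    by (simp add: computable_div2 computable_arg)
  then have "decidable k {xs. (g xs div 2 ^ f xs) mod 2 = 1}"
    by (intro decidable_eq computable_mod2 computable_const)
  then show ?thesis
    by (simp add: set_decode_def odd_iff_mod_2_eq_one)
qed

lemma computable_bounded_graph:
  assumes graph: "decidable 2 {ys. arg 0 ys = f (arg 1 ys)}"
    and bound: "\<And>n. f n \<le> n" and g: "computable k g"
  shows "computable k (\<lambda>xs. f (g xs))"
proof (rule computable_compose1[OF _ g])
  \<comment> \<open>The default 0 stands until the counter has passed \<open>f n\<close>; since
    \<open>f n \<le> n\<close>, this has happened after \<open>Suc n\<close> rounds.\<close>
  have "rec_nat 0 (\<lambda>m y. if m = f n then m else y) b = (if f n < b then f n else 0)" for n b
    by (induction b) auto
  then have "rec_nat 0 (\<lambda>m y. if m = f n then m else y) (Suc n) = f n" for n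
    using bound[of n] by (simp only: less_Suc_eq_le if_True)
  moreover have "computable 1
      (\<lambda>xs. rec_nat 0 (\<lambda>m y. if m = f (arg 0 xs) then m else y) (Suc (arg 0 xs)))"
  proof (intro computable_rec_nat computable_zero computable_if computable_arg computable_Suc)
    have "decidable (Suc (Suc 1))
        {ys. map (\<lambda>g. g ys) [arg 0, arg 2] \<in> {ys. arg 0 ys = f (arg 1 ys)}}"
      using graph computable_arg by (intro decidable_compose) (auto simp: numeral_2_eq_2)
    then show "decidable (Suc (Suc 1)) {ys. arg 0 ys = f (arg 0 (tl (tl ys)))}"
      by (simp add: arg_tl numeral_2_eq_2)
  qed
  ultimately show "computable 1 (\<lambda>ys. f (arg 0 ys))" by simp
qed

section \<open>Projections of the pairing function\<close>

definition pfst :: "nat \<Rightarrow> nat" where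
  "pfst n = fst (prod_decode n)"

definition psnd :: "nat \<Rightarrow> nat" where
  "psnd n = snd (prod_decode n)"

lemma pfst_psnd_prod_encode [simp]:
  "pfst (prod_encode (a, b)) = a" "psnd (prod_encode (a, b)) = b"
  by (simp_all add: pfst_def psnd_def)

lemma prod_encode_pfst_psnd [simp]: "prod_encode (pfst n, psnd n) = n"
  by (simp add: pfst_def psnd_def)

lemma pfst_le: "pfst n \<le> n" and psnd_le: "psnd n \<le> n"
  by (metis prod_encode_pfst_psnd le_prod_encode_1) (metis prod_encode_pfst_psnd le_prod_encode_2)

lemma computable_pfst:
  assumes "computable k f"
  shows "computable k (\<lambda>xs. pfst (f xs))"
proof (rule computable_bounded_graph[OF _ pfst_le assms])
  \<comment> \<open>A component is at most the code of its pair, so the missing one is found below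
    \<open>Suc n\<close>.\<close>
  have "m = pfst n \<longleftrightarrow> (\<exists>j<Suc n. prod_encode (m, j) = n)" for m n
    by (metis le_imp_less_Suc pfst_psnd_prod_encode(1) prod_encode_pfst_psnd psnd_le)
  moreover have "decidable 2 {ys. \<exists>j<Suc (arg 1 ys). prod_encode (arg 0 ys, j) = arg 1 ys}"
    by (simp add: decidable_bex decidable_eq computable_prod_encode computable_Suc computable_arg
        arg_tl del: prod_encode_eq ex_simps)
  ultimately show "decidable 2 {ys. arg 0 ys = pfst (arg 1 ys)}" by simp
qed

lemma computable_psnd:
  assumes "computable k f"
  shows "computable k (\<lambda>xs. psnd (f xs))"
proof (rule computable_bounded_graph[OF _ psnd_le assms])
  have "m = psnd n \<longleftrightarrow> (\<exists>j<Suc n. prod_encode (j, m) = n)" for m n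
    by (metis le_imp_less_Suc pfst_psnd_prod_encode(2) prod_encode_pfst_psnd pfst_le)
  moreover have "decidable 2 {ys. \<exists>j<Suc (arg 1 ys). prod_encode (j, arg 0 ys) = arg 1 ys}"
    by (simp add: decidable_bex decidable_eq computable_prod_encode computable_Suc computable_arg
        arg_tl del: prod_encode_eq ex_simps)
  ultimately show "decidable 2 {ys. arg 0 ys = psnd (arg 1 ys)}" by simp
qed

lemmas computability_intros =
  computable_arg computable_const computable_Suc computable_add computable_mult
  computable_div2 computable_prod_encode computable_pfst computable_psnd
  decidable_not decidable_conj decidable_disj decidable_imp decidable_eq
  decidable_bex decidable_ball decidable_set_decode

section \<open>Closure properties of the arithmetical hierarchy\<close>

lemma ex_Compl: "(\<exists>R. P R) \<longleftrightarrow> (\<exists>R :: 'a set. P (- R))"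
  by (metis double_complement)

text \<open>De Morgan at each quantifier. Everything about the hierarchy can thus be stated for
  \<open>Sigma0\<close>, and inductions on the level follow one predicate.\<close>

lemma Pi0_iff_Sigma0_Compl: "Pi0 n k A \<longleftrightarrow> Sigma0 n k (- A)"
proof (induction n arbitrary: k A)
  case 0
  show ?case
    using decidable_not[of k "\<lambda>xs. xs \<in> A"] decidable_not[of k "\<lambda>xs. xs \<notin> A"]
    by (auto simp: Compl_eq)
next
  case (Suc n)
  have "Sigma0 (Suc n) k (- A) \<longleftrightarrow>
      (\<exists>R. Pi0 n (Suc k) (- R) \<and> (\<forall>xs. length xs = k \<longrightarrow> (xs \<in> - A \<longleftrightarrow> (\<exists>y. y # xs \<in> - R))))"
    unfolding Sigma0.simps(2) by (rule ex_Compl)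
  moreover have "(xs \<in> - A \<longleftrightarrow> (\<exists>y. y # xs \<in> - R)) \<longleftrightarrow> (xs \<in> A \<longleftrightarrow> (\<forall>y. y # xs \<in> R))" for xs R
    by auto
  ultimately show ?case
    by (simp only: Suc double_complement Pi0.simps)
qed

lemma Sigma0_Suc_iff: "Sigma0 (Suc n) k A \<longleftrightarrow>
    (\<exists>R. Sigma0 n (Suc k) R \<and> (\<forall>xs. length xs = k \<longrightarrow> (xs \<in> A \<longleftrightarrow> (\<exists>y. y # xs \<notin> R))))"
  unfolding Sigma0.simps(2) Pi0_iff_Sigma0_Compl by (subst ex_Compl) simp

declare Sigma0.simps(2) [simp del]

lemma Sigma0_cong:
  assumes "\<And>xs. length xs = k \<Longrightarrow> xs \<in> A \<longleftrightarrow> xs \<in> B"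
  shows "Sigma0 n k A \<longleftrightarrow> Sigma0 n k B"
  using assms by (cases n) (auto simp: decidable_cong[OF assms] Sigma0_Suc_iff)

text \<open>Substitution passes under the leading quantifier: \<open>arg 0\<close> hands on the
  quantified variable, and the given functions act on the tail.\<close>

lemma Sigma0_compose:
  assumes "Sigma0 n (length gs) A" "\<And>g. g \<in> set gs \<Longrightarrow> computable k g"
  shows "Sigma0 n k {xs. map (\<lambda>g. g xs) gs \<in> A}"
  using assms
proof (induction n arbitrary: k gs A)
  case 0
  then show ?case by (simp add: decidable_compose)
next
  case (Suc n)
  from Suc.prems(1) obtain R where R: "Sigma0 n (Suc (length gs)) R"
    and A: "\<And>xs. length xs = length gs \<Longrightarrow> xs \<in> A \<longleftrightarrow> (\<exists>y. y # xs \<notin> R)"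
    by (auto simp: Sigma0_Suc_iff)
  let ?gs = "arg 0 # map (\<lambda>g ys. g (tl ys)) gs"
  have tl: "computable (Suc k) (\<lambda>ys. g (tl ys))" if "g \<in> set gs" for g
  proof -
    have "computable (Suc k) (\<lambda>ys. g (map (\<lambda>h. h ys) (map (\<lambda>i. arg (Suc i)) [0..<k])))"
      using Suc.prems(2)[OF that] computable_arg by (intro computable_compose) auto
    then show ?thesis
      by (rule computable_cong[THEN iffD1, rotated]) (simp add: map_arg_Suc comp_def)
  qed
  have "Sigma0 n (Suc k) {ys. map (\<lambda>g. g ys) ?gs \<in> R}"
    using R tl computable_arg by (intro Suc.IH) auto
  then show ?case
    by (auto simp: Sigma0_Suc_iff A comp_def intro!: exI[of _ "{ys. map (\<lambda>g. g ys) ?gs \<in> R}"])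
qed

lemma Sigma0_tl:
  assumes "Sigma0 n k A"
  shows "Sigma0 n (Suc k) {ys. tl ys \<in> A}"
proof -
  have "Sigma0 n (Suc k) {ys. map (\<lambda>g. g ys) (map (\<lambda>i. arg (Suc i)) [0..<k]) \<in> A}"
    using assms computable_arg by (intro Sigma0_compose) auto
  then show ?thesis
    by (rule Sigma0_cong[THEN iffD1, rotated]) (simp add: map_arg_Suc comp_def)
qed

text \<open>Serves to merge quantifiers: the head holds a code, from which \<open>gs\<close> compute
  the variables it stands for.\<close>

lemma Sigma0_hd:
  assumes A: "Sigma0 n (length gs + k) A" and gs: "\<And>g. g \<in> set gs \<Longrightarrow> computable (Suc k) g"
  shows "Sigma0 n (Suc k) {ys. map (\<lambda>g. g ys) gs @ tl ys \<in> A}"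
proof -
  have "Sigma0 n (Suc k) {ys. map (\<lambda>g. g ys) (gs @ map (\<lambda>i. arg (Suc i)) [0..<k]) \<in> A}"
    using assms computable_arg by (intro Sigma0_compose) auto
  then show ?thesis
    by (rule Sigma0_cong[THEN iffD1, rotated]) (simp add: map_arg_Suc comp_def)
qed

lemma Sigma0_Suc_of_Compl:
  assumes "Sigma0 n k (- A)"
  shows "Sigma0 (Suc n) k A"
  using Sigma0_tl[OF assms] by (auto simp: Sigma0_Suc_iff)

text \<open>At the bottom a vacuous quantifier is put in front; higher up the inclusion of levels is
  applied under the quantifier.\<close>

lemma Sigma0_Suc: "Sigma0 n k A \<Longrightarrow> Sigma0 (Suc n) k A"
proof (induction n arbitrary: k A)
  case 0
  then show ?case
    using decidable_not[of k "\<lambda>xs. xs \<in> A"] by (intro Sigma0_Suc_of_Compl) (simp add: Compl_eq)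
next
  case (Suc n)
  from Suc.prems obtain R where "Sigma0 n (Suc k) R"
    "\<forall>xs. length xs = k \<longrightarrow> (xs \<in> A \<longleftrightarrow> (\<exists>y. y # xs \<notin> R))"
    unfolding Sigma0_Suc_iff by blast
  with Suc.IH show ?case unfolding Sigma0_Suc_iff[of "Suc n"] by blast
qed

lemma Sigma0_mono: "m \<le> n \<Longrightarrow> Sigma0 m k A \<Longrightarrow> Sigma0 n k A"
  by (induction n rule: dec_induct) (auto intro: Sigma0_Suc)

lemma Sigma0_decidable: "decidable k A \<Longrightarrow> Sigma0 n k A"
  using Sigma0_mono[of 0 n k A] by simp

text \<open>Each level is built from complements of the one below, so intersections depend on unions
  there and vice versa; hence one joint induction.\<close>

lemma Sigma0_Int_Un:
  "Sigma0 n k A \<Longrightarrow> Sigma0 n k B \<Longrightarrow> Sigma0 n k (A \<inter> B) \<and> Sigma0 n k (A \<union> B)"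
proof (induction n arbitrary: k A B)
  case 0
  then show ?case
    using decidable_conj[of k "\<lambda>xs. xs \<in> A" "\<lambda>xs. xs \<in> B"]
      decidable_disj[of k "\<lambda>xs. xs \<in> A" "\<lambda>xs. xs \<in> B"]
    by (simp add: Int_def Un_def)
next
  case (Suc n)
  from Suc.prems obtain R S where RS: "Sigma0 n (Suc k) R" "Sigma0 n (Suc k) S"
    and A: "\<And>xs. length xs = k \<Longrightarrow> xs \<in> A \<longleftrightarrow> (\<exists>y. y # xs \<notin> R)"
    and B: "\<And>xs. length xs = k \<Longrightarrow> xs \<in> B \<longleftrightarrow> (\<exists>y. y # xs \<notin> S)"
    by (auto simp: Sigma0_Suc_iff)
  \<comment> \<open>An intersection needs two witnesses, which are packed into one number. For the
    union below, a single witness outside \<open>R \<inter> S\<close> suffices.\<close>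
  let ?R = "{ys. map (\<lambda>g. g ys) [\<lambda>ys. pfst (arg 0 ys)] @ tl ys \<in> R}"
  let ?S = "{ys. map (\<lambda>g. g ys) [\<lambda>ys. psnd (arg 0 ys)] @ tl ys \<in> S}"
  have "Sigma0 n (Suc k) ?R" "Sigma0 n (Suc k) ?S"
    by (rule Sigma0_hd; use RS in \<open>auto intro!: computability_intros\<close>)+
  with Suc.IH have "Sigma0 n (Suc k) (?R \<union> ?S)" by blast
  moreover have "xs \<in> A \<inter> B \<longleftrightarrow> (\<exists>w. w # xs \<notin> ?R \<union> ?S)" if "length xs = k" for xs
    using that by (auto simp: A B) (metis pfst_psnd_prod_encode)
  ultimately have "Sigma0 (Suc n) k (A \<inter> B)"
    unfolding Sigma0_Suc_iff by blast
  moreover have "Sigma0 (Suc n) k (A \<union> B)"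
    unfolding Sigma0_Suc_iff using Suc.IH[OF RS] by (auto simp: A B intro!: exI[of _ "R \<inter> S"])
  ultimately show ?case ..
qed

lemma Sigma0_conj:
  "Sigma0 n k {xs. P xs} \<Longrightarrow> Sigma0 n k {xs. Q xs} \<Longrightarrow> Sigma0 n k {xs. P xs \<and> Q xs}"
  using Sigma0_Int_Un by (simp add: Collect_conj_eq)

lemma Sigma0_disj:
  "Sigma0 n k {xs. P xs} \<Longrightarrow> Sigma0 n k {xs. Q xs} \<Longrightarrow> Sigma0 n k {xs. P xs \<or> Q xs}"
  using Sigma0_Int_Un by (simp add: Collect_disj_eq)

text \<open>Two adjacent existential quantifiers merge into one over coded pairs.\<close>

lemma Sigma0_ex:
  assumes "Sigma0 (Suc n) (Suc k) {ys. P (arg 0 ys) (tl ys)}"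
  shows "Sigma0 (Suc n) k {xs. \<exists>w. P w xs}"
proof -
  from assms obtain R where R: "Sigma0 n (Suc (Suc k)) R"
    and P: "\<And>ys. length ys = Suc k \<Longrightarrow> P (arg 0 ys) (tl ys) \<longleftrightarrow> (\<exists>y. y # ys \<notin> R)"
    by (auto simp: Sigma0_Suc_iff)
  have P: "P w xs \<longleftrightarrow> (\<exists>y. y # w # xs \<notin> R)" if "length xs = k" for w xs
    using P[of "w # xs"] that by simp
  let ?R = "{ys. map (\<lambda>g. g ys) [\<lambda>ys. pfst (arg 0 ys), \<lambda>ys. psnd (arg 0 ys)] @ tl ys \<in> R}"
  have "Sigma0 n (Suc k) ?R"
    using R by (intro Sigma0_hd) (auto intro!: computability_intros)
  moreover have "(\<exists>w. P w xs) \<longleftrightarrow> (\<exists>w. w # xs \<notin> ?R)" if "length xs = k" for xs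
    using that by (auto simp: P) (metis pfst_psnd_prod_encode)
  ultimately show ?thesis
    unfolding Sigma0_Suc_iff by (intro exI[of _ ?R]) simp
qed

section \<open>Closure properties of \<open>Delta0\<close>\<close>

lemma Delta0_iff: "Delta0 n k A \<longleftrightarrow> Sigma0 n k A \<and> Sigma0 n k (- A)"
  by (simp add: Delta0_def Pi0_iff_Sigma0_Compl)

lemma Delta0_decidable: "decidable k {xs. P xs} \<Longrightarrow> Delta0 n k {xs. P xs}"
  by (simp add: Delta0_iff Sigma0_decidable decidable_not Collect_neg_eq[symmetric])

lemma Delta0_conj:
  "Delta0 n k {xs. P xs} \<Longrightarrow> Delta0 n k {xs. Q xs} \<Longrightarrow> Delta0 n k {xs. P xs \<and> Q xs}"
  unfolding Delta0_iff Collect_neg_eq[symmetric] de_Morgan_conj de_Morgan_disj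
  by (elim conjE) (intro conjI Sigma0_conj Sigma0_disj)

lemma Delta0_disj:
  "Delta0 n k {xs. P xs} \<Longrightarrow> Delta0 n k {xs. Q xs} \<Longrightarrow> Delta0 n k {xs. P xs \<or> Q xs}"
  unfolding Delta0_iff Collect_neg_eq[symmetric] de_Morgan_conj de_Morgan_disj
  by (elim conjE) (intro conjI Sigma0_conj Sigma0_disj)

lemma Delta0_compose:
  assumes "Delta0 n (length gs) A" "\<And>g. g \<in> set gs \<Longrightarrow> computable k g"
  shows "Delta0 n k {xs. map (\<lambda>g. g xs) gs \<in> A}"
  using assms Sigma0_compose[of n gs A k] Sigma0_compose[of n gs "- A" k]
  by (simp add: Delta0_iff Collect_neg_eq[symmetric])

text \<open>
  Substitution of partial computable functions: these have \<open>\<Delta>\<^sub>2\<close> domains, and the least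
  witness makes them single-valued.
\<close>

lemma Delta0_compose_Least:
  assumes n: "n \<ge> 2" and A: "Delta0 n (length gs) A"
    and gs: "\<And>g. g \<in> set gs \<Longrightarrow> computable (Suc k) g"
    and T: "decidable (Suc k) {ys. T (arg 0 ys) (tl ys)}"
  shows "Delta0 n k {xs. (\<exists>w. T w xs) \<and> map (\<lambda>g. g ((LEAST w. T w xs) # xs)) gs \<in> A}"
proof -
  from n obtain m where m: "n = Suc (Suc m)"
    by (metis add_2_eq_Suc le_Suc_ex)
  \<comment> \<open>\<open>M\<close> singles out the least witness with a bounded quantifier, hence
    decidably; statements about the least witness become existential.\<close>
  define M where "M w xs \<longleftrightarrow> T w xs \<and> (\<forall>v<w. \<not> T v xs)" for w xs
  have M: "decidable (Suc k) {ys. M (arg 0 ys) (tl ys)}"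
    unfolding M_def by (intro computability_intros T decidable_tl_tl)
  have M_Least: "(\<exists>w. M w xs \<and> Q w) \<longleftrightarrow> (\<exists>w. T w xs) \<and> Q (LEAST w. T w xs)" for xs Q
  proof
    assume "\<exists>w. M w xs \<and> Q w"
    then obtain w where "M w xs" "Q w" by blast
    moreover from this have "(LEAST w. T w xs) = w"
      unfolding M_def by (intro Least_equality) (auto simp: not_less[symmetric])
    ultimately show "(\<exists>w. T w xs) \<and> Q (LEAST w. T w xs)"
      by (auto simp: M_def)
  next
    assume "(\<exists>w. T w xs) \<and> Q (LEAST w. T w xs)"
    then show "\<exists>w. M w xs \<and> Q w"
      by (intro exI[of _ "LEAST w. T w xs"]) (auto simp: M_def dest: not_less_Least intro: LeastI)
  qed
  have *: "Sigma0 n k {xs. (\<exists>w. T w xs) \<and> map (\<lambda>g. g ((LEAST w. T w xs) # xs)) gs \<in> B}"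
    if "Sigma0 n (length gs) B" for B
  proof -
    have "Sigma0 n (Suc k) {ys. map (\<lambda>g. g ys) gs \<in> B}"
      using that gs by (rule Sigma0_compose)
    with Sigma0_decidable[OF M]
    have "Sigma0 n (Suc k) {ys. M (arg 0 ys) (tl ys) \<and> map (\<lambda>g. g ys) gs \<in> B}"
      by (intro Sigma0_conj)
    also have "?this \<longleftrightarrow>
        Sigma0 n (Suc k) {ys. M (arg 0 ys) (tl ys) \<and> map (\<lambda>g. g (arg 0 ys # tl ys)) gs \<in> B}"
      by (rule Sigma0_cong) (auto simp: length_Suc_conv)
    finally have "Sigma0 n k {xs. \<exists>w. M w xs \<and> map (\<lambda>g. g (w # xs)) gs \<in> B}"
      unfolding m by (rule Sigma0_ex)
    then show ?thesis by (simp only: M_Least)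
  qed
  \<comment> \<open>Having a witness is \<open>Sigma0\<close> of level \<open>Suc m\<close>, so
    having none is \<open>Sigma0\<close> of level \<open>Suc (Suc m)\<close>. This is what
    \<open>n \<ge> 2\<close> is for.\<close>
  have "Sigma0 (Suc m) k (- {xs. \<not> (\<exists>w. T w xs)})"
    using Sigma0_ex[OF Sigma0_decidable[OF T]] by (simp add: Collect_neg_eq[symmetric])
  then have "Sigma0 n k {xs. \<not> (\<exists>w. T w xs)}"
    unfolding m by (rule Sigma0_Suc_of_Compl)
  moreover from A have "Sigma0 n (length gs) (- A)"
    by (simp add: Delta0_iff)
  \<comment> \<open>The complement splits into the inputs without a witness and those whose values
    miss \<open>A\<close>; the latter are again of existential form.\<close>
  ultimately have "Sigma0 n k {xs. \<not> (\<exists>w. T w xs) \<or>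
      (\<exists>w. T w xs) \<and> map (\<lambda>g. g ((LEAST w. T w xs) # xs)) gs \<in> - A}"
    by (intro Sigma0_disj *)
  also have "{xs. \<not> (\<exists>w. T w xs) \<or>
      (\<exists>w. T w xs) \<and> map (\<lambda>g. g ((LEAST w. T w xs) # xs)) gs \<in> - A} =
      - {xs. (\<exists>w. T w xs) \<and> map (\<lambda>g. g ((LEAST w. T w xs) # xs)) gs \<in> A}"
    by auto
  finally show ?thesis using * A unfolding Delta0_iff by blast
qed

section \<open>Kleene's enumeration of the partial computable functions\<close>

primrec encode :: "recf \<Rightarrow> nat" where
  "encode Zero = prod_encode (0, 0)"
| "encode Succ = prod_encode (1, 0)"
| "encode (Proj i) = prod_encode (2, i)"
| "encode (Comp f gs) = prod_encode (3, prod_encode (encode f, list_encode (map encode gs)))"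
| "encode (PrimRec f g) = prod_encode (4, prod_encode (encode f, encode g))"
| "encode (Mu f) = prod_encode (5, encode f)"

text \<open>Judgements are numbers, so that a finite set of them is coded by
  \<open>set_encode\<close>; the tag \<open>t\<close> keeps the kinds apart.\<close>

definition judgement :: "nat \<Rightarrow> nat \<Rightarrow> nat \<Rightarrow> nat \<Rightarrow> nat" where
  "judgement t a b c = prod_encode (t, prod_encode (a, prod_encode (b, c)))"

lemma judgement_eq_iff [simp]:
  "judgement t a b c = judgement t' a' b' c' \<longleftrightarrow> t = t' \<and> a = a' \<and> b = b' \<and> c = c'"
  by (simp add: judgement_def)

text \<open>List construction on the codes given by \<open>list_encode\<close>, where 0 codes the
  empty list.\<close>

abbreviation cons :: "nat \<Rightarrow> nat \<Rightarrow> nat" where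
  "cons x xs \<equiv> Suc (prod_encode (x, xs))"

text \<open>
  Program \<open>e\<close> halts on \<open>xs\<close> with output \<open>y\<close>; the programs \<open>gs\<close> halt on \<open>xs\<close> with outputs \<open>ys\<close>; the
  \<open>i\<close>-th entry of \<open>xs\<close> is \<open>y\<close>; program \<open>f\<close> has positive outputs on \<open>i # xs\<close> for all \<open>i < z\<close>.
\<close>

abbreviation "halts \<equiv> judgement 0"
abbreviation "halts_all \<equiv> judgement 1"
abbreviation "entry \<equiv> judgement 2"
abbreviation "positive \<equiv> judgement 3"

text \<open>
  The bound \<open>B\<close> on all parameters only serves to make this one-step relation decidable.
\<close>

inductive step :: "nat \<Rightarrow> nat set \<Rightarrow> nat \<Rightarrow> bool" for B S where
  Zero: "xs < B \<Longrightarrow> step B S (halts (prod_encode (0, 0)) xs 0)"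
| Succ: "x < B \<Longrightarrow> step B S (halts (prod_encode (1, 0)) (cons x 0) (Suc x))"
| Proj: "i < B \<Longrightarrow> xs < B \<Longrightarrow> y < B \<Longrightarrow> entry i xs y \<in> S
    \<Longrightarrow> step B S (halts (prod_encode (2, i)) xs y)"
| Comp: "f < B \<Longrightarrow> gs < B \<Longrightarrow> xs < B \<Longrightarrow> ys < B \<Longrightarrow> z < B
    \<Longrightarrow> halts_all gs xs ys \<in> S \<Longrightarrow> halts f ys z \<in> S
    \<Longrightarrow> step B S (halts (prod_encode (3, prod_encode (f, gs))) xs z)"
| PrimRec_0: "f < B \<Longrightarrow> g < B \<Longrightarrow> xs < B \<Longrightarrow> y < B \<Longrightarrow> halts f xs y \<in> S
    \<Longrightarrow> step B S (halts (prod_encode (4, prod_encode (f, g))) (cons 0 xs) y)"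
| PrimRec_Suc: "f < B \<Longrightarrow> g < B \<Longrightarrow> m < B \<Longrightarrow> xs < B \<Longrightarrow> y < B \<Longrightarrow> z < B
    \<Longrightarrow> halts (prod_encode (4, prod_encode (f, g))) (cons m xs) y \<in> S
    \<Longrightarrow> halts g (cons m (cons y xs)) z \<in> S
    \<Longrightarrow> step B S (halts (prod_encode (4, prod_encode (f, g))) (cons (Suc m) xs) z)"
| Mu: "f < B \<Longrightarrow> xs < B \<Longrightarrow> z < B \<Longrightarrow> positive f xs z \<in> S \<Longrightarrow> halts f (cons z xs) 0 \<in> S
    \<Longrightarrow> step B S (halts (prod_encode (5, f)) xs z)"
| halts_all_Nil: "xs < B \<Longrightarrow> step B S (halts_all 0 xs 0)"
| halts_all_Cons: "g < B \<Longrightarrow> gs < B \<Longrightarrow> xs < B \<Longrightarrow> y < B \<Longrightarrow> ys < B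
    \<Longrightarrow> halts g xs y \<in> S \<Longrightarrow> halts_all gs xs ys \<in> S
    \<Longrightarrow> step B S (halts_all (cons g gs) xs (cons y ys))"
| entry_0: "x < B \<Longrightarrow> xs < B \<Longrightarrow> step B S (entry 0 (cons x xs) x)"
| entry_Suc: "i < B \<Longrightarrow> x < B \<Longrightarrow> xs < B \<Longrightarrow> y < B \<Longrightarrow> entry i xs y \<in> S
    \<Longrightarrow> step B S (entry (Suc i) (cons x xs) y)"
| positive_0: "f < B \<Longrightarrow> xs < B \<Longrightarrow> step B S (positive f xs 0)"
| positive_Suc: "f < B \<Longrightarrow> xs < B \<Longrightarrow> z < B \<Longrightarrow> v < B
    \<Longrightarrow> positive f xs z \<in> S \<Longrightarrow> halts f (cons z xs) (Suc v) \<in> S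
    \<Longrightarrow> step B S (positive f xs (Suc z))"

lemma step_mono: "step B S c \<Longrightarrow> B \<le> B' \<Longrightarrow> S \<subseteq> S' \<Longrightarrow> step B' S' c"
  by (induction rule: step.induct)
    (rule step.intros; (erule (1) less_le_trans | erule (1) subsetD[rotated]))+

text \<open>Brings the rules into a form built from bounded quantifiers, equations and membership,
  each of which preserves decidability.\<close>

lemma step_bounded_iff: "step B S c \<longleftrightarrow>
    (\<exists>xs<B. c = halts (prod_encode (0, 0)) xs 0) \<or>
    (\<exists>x<B. c = halts (prod_encode (1, 0)) (cons x 0) (Suc x)) \<or>
    (\<exists>i<B. \<exists>xs<B. \<exists>y<B. c = halts (prod_encode (2, i)) xs y \<and> entry i xs y \<in> S) \<or>
    (\<exists>f<B. \<exists>gs<B. \<exists>xs<B. \<exists>ys<B. \<exists>z<B. c = halts (prod_encode (3, prod_encode (f, gs))) xs z \<and>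
      halts_all gs xs ys \<in> S \<and> halts f ys z \<in> S) \<or>
    (\<exists>f<B. \<exists>g<B. \<exists>xs<B. \<exists>y<B. c = halts (prod_encode (4, prod_encode (f, g))) (cons 0 xs) y \<and>
      halts f xs y \<in> S) \<or>
    (\<exists>f<B. \<exists>g<B. \<exists>m<B. \<exists>xs<B. \<exists>y<B. \<exists>z<B.
      c = halts (prod_encode (4, prod_encode (f, g))) (cons (Suc m) xs) z \<and>
      halts (prod_encode (4, prod_encode (f, g))) (cons m xs) y \<in> S \<and>
      halts g (cons m (cons y xs)) z \<in> S) \<or>
    (\<exists>f<B. \<exists>xs<B. \<exists>z<B. c = halts (prod_encode (5, f)) xs z \<and>
      positive f xs z \<in> S \<and> halts f (cons z xs) 0 \<in> S) \<or>
    (\<exists>xs<B. c = halts_all 0 xs 0) \<or>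
    (\<exists>g<B. \<exists>gs<B. \<exists>xs<B. \<exists>y<B. \<exists>ys<B. c = halts_all (cons g gs) xs (cons y ys) \<and>
      halts g xs y \<in> S \<and> halts_all gs xs ys \<in> S) \<or>
    (\<exists>x<B. \<exists>xs<B. c = entry 0 (cons x xs) x) \<or>
    (\<exists>i<B. \<exists>x<B. \<exists>xs<B. \<exists>y<B. c = entry (Suc i) (cons x xs) y \<and> entry i xs y \<in> S) \<or>
    (\<exists>f<B. \<exists>xs<B. c = positive f xs 0) \<or>
    (\<exists>f<B. \<exists>xs<B. \<exists>z<B. \<exists>v<B. c = positive f xs (Suc z) \<and>
      positive f xs z \<in> S \<and> halts f (cons z xs) (Suc v) \<in> S)"
  (is "_ \<longleftrightarrow> ?rhs")
proof
  assume "step B S c"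
  then show ?rhs by cases (simp_all, blast+)
next
  assume ?rhs
  then show "step B S c" by (elim disjE exE conjE) (simp_all add: step.intros step.intros[simplified])
qed

section \<open>Derivations and their decidability\<close>

definition derivation :: "nat \<Rightarrow> nat set \<Rightarrow> bool" where
  "derivation B S \<longleftrightarrow> (\<forall>c\<in>S. step B S c)"

lemma decidable_derivation:
  "decidable k {xs. derivation (arg i xs) (set_decode (arg j xs))}"
proof -
  \<comment> \<open>A member satisfies \<open>2 ^ c \<le> D\<close>, so quantification over the
    members is bounded.\<close>
  have "c < D" if "c \<in> set_decode D" for c D
    using that by (metis bot_nat_0.extremum_unique div_less even_zero less_exp linorder_not_less
        order_less_le_trans set_decode_def mem_Collect_eq)
  then have "derivation B (set_decode D) \<longleftrightarrow>
      (\<forall>c<D. c \<in> set_decode D \<longrightarrow> step B (set_decode D) c)" for B D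
    unfolding derivation_def by blast
  then have "{xs. derivation (arg i xs) (set_decode (arg j xs))} = {xs. \<forall>c<arg j xs.
      c \<in> set_decode (arg j xs) \<longrightarrow> step (arg i xs) (set_decode (arg j xs)) c}"
    by blast
  then show ?thesis
    by (simp only: step_bounded_iff judgement_def)
      ((rule computability_intros | simp only: arg_tl)+)
qed

section \<open>Soundness of derivations\<close>

lemma entry_sound:
  assumes "derivation B S" "entry i (list_encode xs) y \<in> S"
  shows "i < length xs \<and> xs ! i = y"
  using assms(2)
proof (induction xs arbitrary: i)
  case Nil
  with assms(1) have "step B S (entry i 0 y)" by (simp add: derivation_def)
  then show ?case by cases auto
next
  case (Cons x xs)
  with assms(1) have "step B S (entry i (cons x (list_encode xs)) y)"
    by (simp add: derivation_def)
  then show ?case by cases (use Cons.IH in auto)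
qed

text \<open>By inversion of \<open>step\<close>: the shape of the program selects the rule, whose
  premises concern subprograms or, for primitive recursion, also a smaller recursion
  argument.\<close>

lemma halts_sound:
  assumes S: "derivation B S"
  shows "halts (encode p) (list_encode xs) y \<in> S \<Longrightarrow> evaluates p xs y"
proof (induction p arbitrary: xs y)
  case Zero
  with S have "step B S (halts (encode Zero) (list_encode xs) y)" by (simp add: derivation_def)
  then show ?case by cases (auto intro: evaluates.intros)
next
  case Succ
  with S have "step B S (halts (encode Succ) (list_encode xs) y)" by (simp add: derivation_def)
  then show ?case
  proof cases
    case (Succ x)
    then have "list_encode xs = list_encode [x]" by simp
    then have "xs = [x]" by (simp only: list_encode_eq)
    with Succ show ?thesis by (auto intro: evaluates.Succ)
  qed auto
next
  case (Proj i)
  with S have "step B S (halts (encode (Proj i)) (list_encode xs) y)" by (simp add: derivation_def)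
  then show ?case by cases (use entry_sound[OF S] in \<open>auto intro: evaluates.intros\<close>)
next
  case (Comp f gs)
  \<comment> \<open>The inclusion of \<open>gs'\<close> in \<open>gs\<close> keeps the outer
    induction hypothesis available while \<open>gs'\<close> shrinks.\<close>
  have all: "list_all2 (\<lambda>g y. evaluates g xs y) gs' (list_decode ys)"
    if "set gs' \<subseteq> set gs" "halts_all (list_encode (map encode gs')) (list_encode xs) ys \<in> S" for gs' ys
    using that
  proof (induction gs' arbitrary: ys)
    case Nil
    with S have "step B S (halts_all 0 (list_encode xs) ys)" by (simp add: derivation_def)
    then show ?case by cases auto
  next
    case (Cons g gs')
    with S have "step B S
        (halts_all (cons (encode g) (list_encode (map encode gs'))) (list_encode xs) ys)"
      by (simp add: derivation_def)
    then show ?case by cases (use Cons Comp.IH(2) in auto)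
  qed
  from Comp.prems S have "step B S (halts (encode (Comp f gs)) (list_encode xs) y)"
    by (simp add: derivation_def)
  then show ?case
  proof cases
    case (Comp f' gs' xs' ys z)
    \<comment> \<open>Every number codes a list, so the intermediate \<open>ys\<close> can be
      decoded.\<close>
    then have "halts (encode f) (list_encode (list_decode ys)) y \<in> S" by simp
    then have "evaluates f (list_decode ys) y" by (rule Comp.IH(1))
    with Comp all[of gs ys] show ?thesis by (auto intro: evaluates.Comp)
  qed auto
next
  case (PrimRec f g)
  have "evaluates (PrimRec f g) (m # xs') y"
    if "halts (encode (PrimRec f g)) (cons m (list_encode xs')) y \<in> S" for m xs' y
    using that
  proof (induction m arbitrary: y)
    case 0
    with S have "step B S (halts (encode (PrimRec f g)) (cons 0 (list_encode xs')) y)"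
      by (simp add: derivation_def)
    then show ?case by cases (use PrimRec.IH(1) in \<open>auto intro: evaluates.PrimRec_0\<close>)
  next
    case (Suc m)
    with S have "step B S (halts (encode (PrimRec f g)) (cons (Suc m) (list_encode xs')) y)"
      by (simp add: derivation_def)
    then show ?case
    proof cases
      case (PrimRec_Suc f' g' m' xs'' v z)
      then have "evaluates (PrimRec f g) (m # xs') v"
        using Suc.IH by simp
      moreover from PrimRec_Suc have "evaluates g (m # v # xs') y"
        using PrimRec.IH(2)[of "m # v # xs'" y] by simp
      ultimately show ?thesis by (rule evaluates.PrimRec_Suc)
    qed auto
  qed
  moreover from PrimRec.prems S have "step B S (halts (encode (PrimRec f g)) (list_encode xs) y)"
    by (simp add: derivation_def)
  \<comment> \<open>Both rules for primitive recursion conclude about nonempty argument lists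
    only.\<close>
  then obtain m xs' where "xs = m # xs'"
    by cases (cases xs; auto)+
  ultimately show ?case using PrimRec.prems by simp
next
  case (Mu f)
  have pos: "\<forall>i<z. \<exists>v>0. evaluates f (i # xs) v"
    if "positive (encode f) (list_encode xs) z \<in> S" for z
    using that
  proof (induction z)
    case (Suc z)
    with S have "step B S (positive (encode f) (list_encode xs) (Suc z))"
      by (simp add: derivation_def)
    then show ?case
    proof cases
      case (positive_Suc f' xs' z' v)
      with Mu.IH[of "z # xs" "Suc v"] Suc.IH show ?thesis by (auto simp: less_Suc_eq)
    qed auto
  qed simp
  from Mu.prems S have "step B S (halts (encode (Mu f)) (list_encode xs) y)"
    by (simp add: derivation_def)
  then show ?case
    by cases (use pos Mu.IH[of "y # xs" 0] in \<open>auto intro: evaluates.Mu\<close>)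
qed

section \<open>Completeness of derivations\<close>

definition derivable :: "nat \<Rightarrow> bool" where
  "derivable c \<longleftrightarrow> (\<exists>B S. finite S \<and> derivation B S \<and> c \<in> S)"

text \<open>By monotonicity of \<open>step\<close>, the union of two derivations is a derivation for
  the larger bound.\<close>

lemma derivation_common:
  assumes "finite P" "\<forall>c\<in>P. derivable c"
  obtains B S where "finite S" "derivation B S" "P \<subseteq> S"
proof -
  have "\<exists>B S. finite S \<and> derivation B S \<and> P \<subseteq> S"
    using assms
  proof (induction P)
    case empty
    then show ?case by (auto simp: derivation_def)
  next
    case (insert c P)
    then obtain B S B' S' where "finite S" "derivation B S" "P \<subseteq> S"
      "finite S'" "derivation B' S'" "c \<in> S'"
      by (auto simp: derivable_def)
    moreover from this have "derivation (max B B') (S \<union> S')"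
      unfolding derivation_def by (blast intro: step_mono max.cobounded1 max.cobounded2)
    ultimately show ?case by (intro exI[of _ "max B B'"] exI[of _ "S \<union> S'"]) auto
  qed
  with that show ?thesis by blast
qed

text \<open>The derivations of the premises are merged and the conclusion is added. Completeness can
  then be proved one rule at a time, with \<open>P\<close> the set of its premises.\<close>

lemma derivable_step:
  assumes "step B P c" "finite P" "\<forall>d\<in>P. derivable d"
  shows "derivable c"
proof -
  from assms(2,3) obtain B' S where S: "finite S" "derivation B' S" "P \<subseteq> S"
    by (rule derivation_common)
  with assms(1) have "derivation (max B B') (insert c S)"
    unfolding derivation_def
    by (auto intro: step_mono[OF _ max.cobounded1] step_mono[OF _ max.cobounded2])
  with S(1) show ?thesis unfolding derivable_def by blast
qed

lemma derivable_entry: "i < length xs \<Longrightarrow> derivable (entry i (list_encode xs) (xs ! i))"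
proof (induction xs arbitrary: i)
  case (Cons x xs)
  \<comment> \<open>A bound above all parameters of the rule; the choices of \<open>?B\<close> below
    follow the same pattern.\<close>
  let ?B = "Suc (i + x + list_encode xs + (x # xs) ! i)"
  show ?case
  proof (cases i)
    case 0
    then show ?thesis
      using derivable_step[OF step.entry_0[of x ?B "list_encode xs" "{}"]] by simp
  next
    case (Suc j)
    with Cons derivable_step[OF step.entry_Suc[of j ?B x "list_encode xs" "xs ! j"
        "{entry j (list_encode xs) (xs ! j)}"]]
    show ?thesis by simp
  qed
qed simp

lemma derivable_halts: "evaluates p xs y \<Longrightarrow> derivable (halts (encode p) (list_encode xs) y)"
proof (induction rule: evaluates.induct)
  case (Zero xs)
  show ?case
    using derivable_step[OF step.Zero[of "list_encode xs" "Suc (list_encode xs)" "{}"]] by simp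
next
  case (Succ x)
  show ?case
    using derivable_step[OF step.Succ[of x "Suc x" "{}"]] by simp
next
  case (Proj i xs)
  let ?B = "Suc (i + list_encode xs + xs ! i)"
  from derivable_entry[OF Proj]
    derivable_step[OF step.Proj[of i ?B "list_encode xs" "xs ! i"
      "{entry i (list_encode xs) (xs ! i)}"]]
  show ?case by simp
next
  case (Comp xs gs ys f z)
  have "derivable (halts_all (list_encode (map encode gs)) (list_encode xs) (list_encode ys))"
    using Comp.IH(1)
  proof (induction rule: list_all2_induct)
    case Nil
    show ?case
      using derivable_step[OF step.halts_all_Nil[of "list_encode xs" "Suc (list_encode xs)" "{}"]]
      by simp
  next
    case (Cons g gs y ys)
    let ?gs = "list_encode (map encode gs)"
    let ?B = "Suc (encode g + ?gs + list_encode xs + y + list_encode ys)"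
    from Cons derivable_step[OF step.halts_all_Cons[of "encode g" ?B ?gs "list_encode xs" y
        "list_encode ys" "{halts (encode g) (list_encode xs) y,
          halts_all ?gs (list_encode xs) (list_encode ys)}"]]
    show ?case by simp
  qed
  moreover
  let ?gs = "list_encode (map encode gs)"
  let ?B = "Suc (encode f + ?gs + list_encode xs + list_encode ys + z)"
  note derivable_step[OF step.Comp[of "encode f" ?B ?gs "list_encode xs" "list_encode ys" z
      "{halts_all ?gs (list_encode xs) (list_encode ys), halts (encode f) (list_encode ys) z}"]]
  ultimately show ?case using Comp.IH(2) by simp
next
  case (PrimRec_0 f xs y g)
  let ?B = "Suc (encode f + encode g + list_encode xs + y)"
  from PrimRec_0.IH derivable_step[OF step.PrimRec_0[of "encode f" ?B "encode g" "list_encode xs" y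
      "{halts (encode f) (list_encode xs) y}"]]
  show ?case by simp
next
  case (PrimRec_Suc f g m xs y z)
  let ?B = "Suc (encode f + encode g + m + list_encode xs + y + z)"
  from PrimRec_Suc.IH derivable_step[OF step.PrimRec_Suc[of "encode f" ?B "encode g" m
      "list_encode xs" y z "{halts (encode (PrimRec f g)) (cons m (list_encode xs)) y,
        halts (encode g) (cons m (cons y (list_encode xs))) z}"]]
  show ?case by simp
next
  case (Mu f z xs)
  have "derivable (positive (encode f) (list_encode xs) j)" if "j \<le> z" for j
    using that
  proof (induction j)
    case 0
    let ?B = "Suc (encode f + list_encode xs)"
    show ?case
      using derivable_step[OF step.positive_0[of "encode f" ?B "list_encode xs" "{}"]] by simp
  next
    case (Suc j)
    from Suc.prems have "j < z" by simp
    with Mu.IH(2) obtain v where "v > 0" "derivable (halts (encode f) (cons j (list_encode xs)) v)"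
      by auto
    \<comment> \<open>The rule \<open>positive_Suc\<close> expresses positivity of an output by a
      successor.\<close>
    then obtain u where u: "derivable (halts (encode f) (cons j (list_encode xs)) (Suc u))"
      by (cases v) auto
    let ?B = "Suc (encode f + list_encode xs + j + u)"
    from u Suc derivable_step[OF step.positive_Suc[of "encode f" ?B "list_encode xs" j u
        "{positive (encode f) (list_encode xs) j,
          halts (encode f) (cons j (list_encode xs)) (Suc u)}"]]
    show ?case by simp
  qed
  then have "derivable (positive (encode f) (list_encode xs) z)" by simp
  moreover
  let ?B = "Suc (encode f + list_encode xs + z)"
  note derivable_step[OF step.Mu[of "encode f" ?B "list_encode xs" z
      "{positive (encode f) (list_encode xs) z, halts (encode f) (cons z (list_encode xs)) 0}"]]
  ultimately show ?case using Mu.IH(1) by simp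
qed

section \<open>Diagonalisation\<close>

text \<open>
  \<open>w = \<langle>\<langle>a, b\<rangle>, \<langle>B, D\<rangle>\<rangle>\<close> witnesses that program \<open>e\<close> has the outputs \<open>a\<close> on \<open>2e\<close> and \<open>b\<close> on \<open>2e + 1\<close>.
\<close>

definition converges :: "nat \<Rightarrow> nat \<Rightarrow> bool" where
  "converges w e \<longleftrightarrow> derivation (pfst (psnd w)) (set_decode (psnd (psnd w))) \<and>
    halts e (cons (2 * e) 0) (pfst (pfst w)) \<in> set_decode (psnd (psnd w)) \<and>
    halts e (cons (2 * e + 1) 0) (psnd (pfst w)) \<in> set_decode (psnd (psnd w))"

text \<open>The two outputs are read off the least witness, to match
  \<open>Delta0_compose_Least\<close>.\<close>

definition diagonal :: "(nat \<times> nat) set \<Rightarrow> nat set" where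
  "diagonal E = {e. (\<exists>w. converges w e) \<and>
    (pfst (pfst (LEAST w. converges w e)), psnd (pfst (LEAST w. converges w e))) \<notin> E}"

definition diagonal_rel :: "(nat \<times> nat) set \<Rightarrow> (nat \<times> nat) set" where
  "diagonal_rel E = {(x, y). x = y \<or> x div 2 = y div 2 \<and> x div 2 \<in> diagonal E}"

section \<open>Complexity of the diagonal relation and failure of reducibility\<close>

lemma decidable_converges: "decidable k {xs. converges (arg i xs) (arg j xs)}"
proof -
  have "decidable k {xs. map (\<lambda>g. g xs) [\<lambda>xs. pfst (psnd (arg i xs)), \<lambda>xs. psnd (psnd (arg i xs))]
      \<in> {xs. derivation (arg 0 xs) (set_decode (arg 1 xs))}}"
    by (rule decidable_compose[OF decidable_derivation]) (auto intro!: computability_intros)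
  then show ?thesis
    unfolding converges_def judgement_def by (intro computability_intros) simp
qed

lemma Delta0_diagonal:
  assumes "n \<ge> 2" "Delta0_equiv n E"
  shows "Delta0 n 1 {xs. arg 0 xs \<in> diagonal E}"
proof -
  let ?gs = "[\<lambda>ys. pfst (pfst (arg 0 ys)), \<lambda>ys. psnd (pfst (arg 0 ys))]"
  \<comment> \<open>The complement, because the two outputs are to be inequivalent.\<close>
  let ?E = "- {[x, y] | x y. (x, y) \<in> E}"
  have "Delta0 n (length ?gs) ?E"
    using assms(2) by (simp add: Delta0_equiv_def Delta0_iff numeral_2_eq_2)
  with assms(1) have "Delta0 n 1 {xs. (\<exists>w. converges w (arg 0 xs)) \<and>
      map (\<lambda>g. g ((LEAST w. converges w (arg 0 xs)) # xs)) ?gs \<in> ?E}"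
    by (rule Delta0_compose_Least)
      (auto simp: arg_tl intro!: computability_intros decidable_converges)
  then show ?thesis by (simp add: diagonal_def)
qed

lemma Delta0_equiv_diagonal_rel:
  assumes "n \<ge> 2" "Delta0_equiv n E"
  shows "Delta0_equiv n (diagonal_rel E)"
proof -
  have "Delta0 n 2 {xs. map (\<lambda>g. g xs) [\<lambda>xs. arg 0 xs div 2] \<in> {xs. arg 0 xs \<in> diagonal E}}"
    using Delta0_diagonal[OF assms] by (intro Delta0_compose) (auto intro!: computability_intros)
  then have "Delta0 n 2 {xs. arg 0 xs = arg 1 xs \<or>
      arg 0 xs div 2 = arg 1 xs div 2 \<and> arg 0 xs div 2 \<in> diagonal E}"
    by (intro Delta0_disj Delta0_conj) (simp_all add: Delta0_decidable computability_intros)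
  then have "Delta0 n 2 {[x, y] | x y. (x, y) \<in> diagonal_rel E}"
    unfolding Delta0_iff
    by (elim conjE, intro conjI; elim Sigma0_cong[THEN iffD1, rotated])
      (auto simp: diagonal_rel_def numeral_2_eq_2 length_Suc_conv)
  moreover have "equiv UNIV (diagonal_rel E)"
    by (auto simp: diagonal_rel_def intro!: equivI refl_onI symI transI)
  ultimately show ?thesis by (simp add: Delta0_equiv_def)
qed

lemma diagonal_rel_not_reducible: "\<not> computably_reducible (diagonal_rel E) E"
proof
  assume "computably_reducible (diagonal_rel E) E"
  then obtain f where "computable1 f"
    and f: "\<And>x y. (x, y) \<in> diagonal_rel E \<longleftrightarrow> (f x, f y) \<in> E"
    unfolding computably_reducible_def by blast
  then obtain p where p: "\<And>x. evaluates p [x] (f x)"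
    unfolding computable1_def computable_def
    by (metis One_nat_def length_Cons list.sel(1) list.size(3))
  define e where "e = encode p"
  \<comment> \<open>Soundness and determinism: whatever a derivation claims as output of
    \<open>e\<close> is the value of \<open>f\<close>.\<close>
  have out: "y = f x" if "derivation B S" "halts e (cons x 0) y \<in> S" for B S x y
    using that halts_sound[of B S p "[x]" y] evaluates_deterministic[OF p]
    by (simp add: e_def)
  have conv: "pfst (pfst w) = f (2 * e) \<and> psnd (pfst w) = f (2 * e + 1)" if "converges w e" for w
    using that unfolding converges_def
    by (elim conjE) (intro conjI out[of "pfst (psnd w)" "set_decode (psnd (psnd w))"])
  let ?P = "{halts e (cons (2 * e) 0) (f (2 * e)), halts e (cons (2 * e + 1) 0) (f (2 * e + 1))}"
  have "finite ?P" by simp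
  moreover have "\<forall>c\<in>?P. derivable c"
    using derivable_halts[OF p[of "2 * e"]] derivable_halts[OF p[of "2 * e + 1"]]
    by (simp add: e_def)
  ultimately obtain B S where "finite S" "derivation B S" "?P \<subseteq> S"
    by (rule derivation_common)
  \<comment> \<open>Completeness provides some witness. The least one may differ from it, but by
    \<open>conv\<close> it carries the same outputs.\<close>
  then have "converges (prod_encode (prod_encode (f (2 * e), f (2 * e + 1)),
      prod_encode (B, set_encode S))) e"
    by (simp add: converges_def set_encode_inverse)
  then have ex: "\<exists>w. converges w e" ..
  then have "converges (LEAST w. converges w e) e" by (rule LeastI_ex)
  from conv[OF this] ex have "e \<in> diagonal E \<longleftrightarrow> (f (2 * e), f (2 * e + 1)) \<notin> E"
    by (simp add: diagonal_def)
  moreover have "(2 * e, 2 * e + 1) \<in> diagonal_rel E \<longleftrightarrow> e \<in> diagonal E"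
    by (simp add: diagonal_rel_def)
  ultimately show False using f by blast
qed

theorem corollary5p12:
  fixes n :: nat
  assumes "n \<ge> 2"
  shows "\<not> (\<exists>E. Delta0_complete_equiv n E) \<and>
    (\<forall>E. Delta0_equiv n E \<longrightarrow>
      (\<exists>F. Delta0_equiv n F \<and> \<not> computably_reducible F E))"
  using Delta0_equiv_diagonal_rel[OF assms] diagonal_rel_not_reducible
  unfolding Delta0_complete_equiv_def by blast

end
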